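(* For any set $S$ of $n$ integers with $S\subseteq[0,n^2)$, there exist a Monge matrix $M$ and a data structure of size $O(n)$ that returns any entry $M[i,j]$ in $O(1)$ time, such that for every $x\in[0,n^2)$ the predecessor of $x$ in $S$ can be found using $O(1)$ time plus one submatrix minimum query on $M$.
   Context: Here a matrix $M$ is Monge if for all rows $i<j$ and columns $k<\ell$, $M[i,k]+M[j,\ell]\le M[i,\ell]+M[j,k]$. A submatrix minimum query on $M$, given $i_0\le i_1$ and $j_0\le j_1$, returns $\min\{M[i,j]: i\in[i_0,i_1], j\in[j_0,j_1]\}$ (and its position). The predecessor of $x$ in $S$ is the largest $y\in S$ with $y\le x$. Computation is on a word RAM with words of $\Theta(\log n)$ bits; sizes are measured in words. *)

theory Defs
  imports Jordan_Normal_Form.Matrix "HOL.Transcendental"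
begin

definition monge :: "'a::ordered_ab_semigroup_add mat \<Rightarrow> bool" where
  "monge M \<longleftrightarrow>
     (\<forall>i j k l. i < j \<and> j < dim_row M \<and> k < l \<and> l < dim_col M \<longrightarrow>
        M $$ (i, k) + M $$ (j, l) \<le> M $$ (i, l) + M $$ (j, k))"

definition predecessor :: "nat set \<Rightarrow> nat \<Rightarrow> nat option" where
  "predecessor S x =
     (if \<exists>y\<in>S. y \<le> x then Some (Max {y \<in> S. y \<le> x}) else None)"

text \<open>
  A query maps \<open>i0 i1 j0 j1\<close> to the minimum together with the row and the column of an entry
  attaining it. Nothing is assumed about ties between positions, nor about the answers to
  ill-formed queries, so an algorithm that is correct for every \<open>Q\<close> relies on neither.
\<close>

type_synonym query_fun = "nat \<Rightarrow> nat \<Rightarrow> nat \<Rightarrow> nat \<Rightarrow> nat \<times> nat \<times> nat"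

definition answers_submatrix_min :: "nat mat \<Rightarrow> query_fun \<Rightarrow> bool" where
  "answers_submatrix_min M Q \<longleftrightarrow>
     (\<forall>i0 i1 j0 j1. i0 \<le> i1 \<and> i1 < dim_row M \<and> j0 \<le> j1 \<and> j1 < dim_col M \<longrightarrow>
        (case Q i0 i1 j0 j1 of (v, i, j) \<Rightarrow>
           i \<in> {i0..i1} \<and> j \<in> {j0..j1} \<and> v = M $$ (i, j) \<and>
           v = Min {M $$ (i', j') | i' j'. i' \<in> {i0..i1} \<and> j' \<in> {j0..j1}}))"

text \<open>
  A word RAM with word length \<open>w\<close>: words are the naturals below \<open>2 ^ w\<close>, arithmetic is unsigned
  and modulo \<open>2 ^ w\<close>, and addresses are words. The word length is a parameter of the semantics
  and not of the program. A machine halts when its program counter leaves the program. Every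
  instruction, including a submatrix minimum query, takes one step; queries are also counted
  separately.
\<close>

datatype binop =
  OpAdd | OpSub | OpMul | OpDiv | OpMod | OpAnd | OpOr | OpXor | OpShl | OpShr | OpEq | OpLess

datatype instr =
    Const nat nat \<comment> \<open>target register, literal\<close>
  | Binop binop nat nat nat \<comment> \<open>operation, target register, operand registers\<close>
  | Load nat nat \<comment> \<open>target register, address register\<close>
  | Store nat nat \<comment> \<open>address register, source register\<close>
  | JumpZero nat nat \<comment> \<open>tested register, jump target\<close>
  | Query nat nat nat nat nat nat nat
      \<comment> \<open>argument registers for \<open>i0 i1 j0 j1\<close>, target registers for value, row, column\<close>

record ram_state =
  pc :: nat
  regs :: "nat \<Rightarrow> nat"
  mem :: "nat \<Rightarrow> nat"
  queries :: nat

fun binop_result :: "nat \<Rightarrow> binop \<Rightarrow> nat \<Rightarrow> nat \<Rightarrow> nat" where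
  "binop_result w OpAdd a b = (a + b) mod 2 ^ w"
| "binop_result w OpSub a b = nat ((int a - int b) mod 2 ^ w)"
| "binop_result w OpMul a b = (a * b) mod 2 ^ w"
| "binop_result w OpDiv a b = a div b"
| "binop_result w OpMod a b = a mod b"
| "binop_result w OpAnd a b = Bit_Operations.and a b"
| "binop_result w OpOr a b = Bit_Operations.or a b"
| "binop_result w OpXor a b = Bit_Operations.xor a b"
| "binop_result w OpShl a b = push_bit b a mod 2 ^ w"
| "binop_result w OpShr a b = drop_bit b a"
| "binop_result w OpEq a b = (of_bool (a = b)) mod 2 ^ w"
| "binop_result w OpLess a b = (of_bool (a < b)) mod 2 ^ w"

fun exec_instr :: "nat \<Rightarrow> query_fun \<Rightarrow> instr \<Rightarrow> ram_state \<Rightarrow> ram_state" where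
  "exec_instr w Q (Const r k) s =
     s\<lparr>pc := pc s + 1, regs := (regs s)(r := k mod 2 ^ w)\<rparr>"
| "exec_instr w Q (Binop f r a b) s =
     s\<lparr>pc := pc s + 1, regs := (regs s)(r := binop_result w f (regs s a) (regs s b))\<rparr>"
| "exec_instr w Q (Load r a) s =
     s\<lparr>pc := pc s + 1, regs := (regs s)(r := mem s (regs s a))\<rparr>"
| "exec_instr w Q (Store a r) s =
     s\<lparr>pc := pc s + 1, mem := (mem s)(regs s a := regs s r)\<rparr>"
| "exec_instr w Q (JumpZero r l) s =
     s\<lparr>pc := (if regs s r = 0 then l else pc s + 1)\<rparr>"
| "exec_instr w Q (Query a b c d rv ri rj) s =
     (case Q (regs s a) (regs s b) (regs s c) (regs s d) of (v, i, j) \<Rightarrow>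
        s\<lparr>pc := pc s + 1,
          regs := (regs s)(rv := v mod 2 ^ w, ri := i mod 2 ^ w, rj := j mod 2 ^ w),
          queries := queries s + 1\<rparr>)"

definition halted :: "instr list \<Rightarrow> ram_state \<Rightarrow> bool" where
  "halted p s \<longleftrightarrow> length p \<le> pc s"

definition step :: "nat \<Rightarrow> query_fun \<Rightarrow> instr list \<Rightarrow> ram_state \<Rightarrow> ram_state" where
  "step w Q p s = (if halted p s then s else exec_instr w Q (p ! pc s) s)"

definition zero_padded :: "nat list \<Rightarrow> nat \<Rightarrow> nat" where
  "zero_padded xs k = (if k < length xs then xs ! k else 0)"

text \<open>
  A computation starts with the data structure \<open>D\<close> in the first memory cells and the inputs in
  the first registers. A halted state is a fixed point of \<^const>\<open>step\<close>, so \<open>halted p (run w Q p t D xs)\<close>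
  says that \<open>p\<close> halts within \<open>t\<close> steps.
\<close>

definition run ::
  "nat \<Rightarrow> query_fun \<Rightarrow> instr list \<Rightarrow> nat \<Rightarrow> nat list \<Rightarrow> nat list \<Rightarrow> ram_state" where
  "run w Q p t D xs =
     (step w Q p ^^ t) \<lparr>pc = 0, regs = zero_padded xs, mem = zero_padded D, queries = 0\<rparr>"

definition returns_entry ::
  "nat \<Rightarrow> nat \<Rightarrow> instr list \<Rightarrow> nat list \<Rightarrow> nat mat \<Rightarrow> nat \<Rightarrow> nat \<Rightarrow> bool" where
  "returns_entry w t p D M i j \<longleftrightarrow>
     (\<forall>Q. let s = run w Q p t D [i, j] in
        halted p s \<and> queries s = 0 \<and> regs s 0 = M $$ (i, j))"

text \<open>
  Register 0 tells whether a predecessor exists; if so, register 1 contains it.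
\<close>

definition finds_predecessor ::
  "nat \<Rightarrow> nat \<Rightarrow> instr list \<Rightarrow> nat list \<Rightarrow> nat mat \<Rightarrow> nat set \<Rightarrow> nat \<Rightarrow> bool" where
  "finds_predecessor w t p D M S x \<longleftrightarrow>
     (\<forall>Q. answers_submatrix_min M Q \<longrightarrow>
        (let s = run w Q p t D [x] in
           halted p s \<and> queries s \<le> 1 \<and>
           (case predecessor S x of
              None \<Rightarrow> regs s 0 = 0
            | Some y \<Rightarrow> regs s 0 = 1 \<and> regs s 1 = y)))"

text \<open>
  Words of \<open>\<Theta>(log n)\<close> bits, with \<open>a\<close> and \<open>b\<close> the constants hidden in the lower and the upper
  bound; \<open>n + 2\<close> replaces \<open>n\<close> only to have a positive logarithm for \<open>n \<le> 1\<close>.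
\<close>

definition log_word_length :: "real \<Rightarrow> real \<Rightarrow> nat \<Rightarrow> nat \<Rightarrow> bool" where
  "log_word_length a b n w \<longleftrightarrow>
     a * log 2 (real n + 2) \<le> real w \<and> real w \<le> b * log 2 (real n + 2)"

end

(* The distance from y down to x, with every unit of overshoot y > x penalised by a factor B, is a
   convex function of y - x, so tabulating it over the sorted set S and all x gives a Monge matrix.
   With B = n^2 every overshooting entry exceeds x < n^2; hence the minimum v of column x is
   x minus the predecessor of x if there is one, and v > x otherwise. *)

theory Submission
  imports Defs
begin

section \<open>The penalised distance and its Monge inequality\<close>

definition skew_dist :: "nat \<Rightarrow> nat \<Rightarrow> nat \<Rightarrow> nat" where
  "skew_dist B y x = (if y \<le> x then x - y else B * (y - x))"

definition skew_dist_mat :: "nat \<Rightarrow> nat list \<Rightarrow> nat \<Rightarrow> nat mat" where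
  "skew_dist_mat B ys m = mat (length ys) m (\<lambda>(i, x). skew_dist B (ys ! i) x)"

lemma dim_skew_dist_mat [simp]:
  "dim_row (skew_dist_mat B ys m) = length ys"
  "dim_col (skew_dist_mat B ys m) = m"
  by (simp_all add: skew_dist_mat_def)

lemma index_skew_dist_mat [simp]:
  "i < length ys \<Longrightarrow> x < m \<Longrightarrow> skew_dist_mat B ys m $$ (i, x) = skew_dist B (ys ! i) x"
  by (simp add: skew_dist_mat_def)

text \<open>Terms depending on \<open>x\<close> or \<open>y\<close> alone cancel in the Monge
  inequality, so after this rewriting only the truncated difference \<open>y - x\<close>, scaled by
  \<open>B + 1\<close>, has to be compared.\<close>

lemma skew_dist_add: "skew_dist B y x + y = x + (B + 1) * (y - x)"
  by (simp add: skew_dist_def)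

lemma skew_dist_quadrangle:
  assumes "y \<le> y'" and "x \<le> x'"
  shows "skew_dist B y x + skew_dist B y' x' \<le> skew_dist B y x' + skew_dist B y' x"
proof -
  \<comment> \<open>Truncated subtraction is the positive part of the integer difference, hence
    convex in it.\<close>
  have "(y - x) + (y' - x') \<le> (y - x') + (y' - x)"
    using assms by linarith
  then have "(B + 1) * (y - x) + (B + 1) * (y' - x') \<le> (B + 1) * (y - x') + (B + 1) * (y' - x)"
    by (metis add_mult_distrib2 mult_le_mono2)
  then show ?thesis
    using skew_dist_add[of B y x] skew_dist_add[of B y' x'] skew_dist_add[of B y x']
      skew_dist_add[of B y' x]
    by linarith
qed

lemma monge_skew_dist_mat:
  assumes "sorted ys"
  shows "monge (skew_dist_mat B ys m)"
  using assms unfolding monge_def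
  by (auto intro!: skew_dist_quadrangle simp: sorted_nth_mono)

text \<open>Both the undershoot and the overshoot are below \<open>m\<close>, and the latter is
  scaled by at most \<open>m\<close>. With \<open>B\<close> and \<open>m\<close> equal to
  \<open>n^2\<close> and \<open>K = 2 ^ w\<close>, every entry fits in a word.\<close>

lemma skew_dist_less:
  assumes "y < m" and "x < m" and "m * m \<le> K" and "B \<le> m"
  shows "skew_dist B y x < K"
proof (cases "y \<le> x")
  case True
  then show ?thesis
    using assms le_square[of m] unfolding skew_dist_def if_P[OF True] by linarith
next
  case False
  have "B * (y - x) \<le> m * (y - x)"
    using assms by simp
  also have "\<dots> < m * m"
    using assms by simp
  finally show ?thesis
    using False assms by (simp add: skew_dist_def)
qed

section \<open>Reading predecessors off column minima\<close>

lemma skew_dist_le_iff: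
  assumes "x < B"
  shows "skew_dist B y x \<le> x \<longleftrightarrow> y \<le> x"
proof (cases "y \<le> x")
  case False
  \<comment> \<open>An overshoot is at least 1, so its penalty is at least \<open>B\<close>, which
    exceeds \<open>x\<close>.\<close>
  then have "B * 1 \<le> B * (y - x)"
    by (intro mult_le_mono2) simp
  then have "x < B * (y - x)"
    using assms by linarith
  then show ?thesis
    using False by (simp add: skew_dist_def)
qed (simp add: skew_dist_def)

text \<open>The second conclusion serves to bound \<open>v\<close>: being an entry, it is a word
  whenever the entries are, so the machine stores it without reduction.\<close>

lemma predecessor_column_min:
  assumes Q: "answers_submatrix_min (skew_dist_mat B ys m) Q"
    and "ys \<noteq> []" and "x < m" and "x < B"
    and q: "Q 0 (length ys - 1) x x = (v, i, j)"
  shows "predecessor (set ys) x = (if v \<le> x then Some (x - v) else None)"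
    and "\<exists>y\<in>set ys. v = skew_dist B y x"
proof -
  let ?M = "skew_dist_mat B ys m"
  let ?I = "{0..length ys - 1}"
  \<comment> \<open>As \<open>length ys - 1\<close> is truncated, nonemptiness of \<open>ys\<close>
    is what makes \<open>?I\<close> exactly the set of row indices.\<close>
  have len: "i' < length ys \<longleftrightarrow> i' \<in> ?I" for i'
    using \<open>ys \<noteq> []\<close> by (cases ys) auto
  have "0 \<le> length ys - 1 \<and> length ys - 1 < dim_row ?M \<and> x \<le> x \<and> x < dim_col ?M"
    using assms(2,3) by simp
  from Q[unfolded answers_submatrix_min_def, rule_format, OF this]
  have "i \<in> ?I" and "j = x" and v_nth: "v = ?M $$ (i, j)"
    and Min: "v = Min {?M $$ (i', j') | i' j'. i' \<in> ?I \<and> j' \<in> {x..x}}"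
    unfolding q prod.case by (blast, simp, blast, blast)
  then have i: "i < length ys" and v: "v = skew_dist B (ys ! i) x"
    using assms(3) len[of i] by simp_all
  have min: "v \<le> skew_dist B y x" if y: "y \<in> set ys" for y
  proof -
    from y obtain k where k: "k < length ys" "y = ys ! k"
      by (auto simp: in_set_conv_nth)
    have "finite {?M $$ (i', j') | i' j'. i' \<in> ?I \<and> j' \<in> {x..x}}"
      by (rule finite_image_set2) auto
    moreover have "skew_dist B y x \<in> {?M $$ (i', j') | i' j'. i' \<in> ?I \<and> j' \<in> {x..x}}"
      using k len[of k] assms(3) by force
    ultimately show ?thesis
      unfolding Min by (rule Min_le)
  qed
  show "\<exists>y\<in>set ys. v = skew_dist B y x"
    using i v nth_mem by blast
  show "predecessor (set ys) x = (if v \<le> x then Some (x - v) else None)"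
  proof (cases "v \<le> x")
    case True
    then have le: "ys ! i \<le> x"
      using v skew_dist_le_iff[OF \<open>x < B\<close>] by simp
    then have eq: "ys ! i = x - v"
      by (simp add: v skew_dist_def)
    \<comment> \<open>Among keys not exceeding \<open>x\<close>, a smaller distance means a larger
      key, so minimality of \<open>v\<close> becomes maximality of \<open>ys ! i\<close>.\<close>
    have "Max {y \<in> set ys. y \<le> x} = ys ! i"
    proof (rule Max_eqI)
      fix y assume "y \<in> {y \<in> set ys. y \<le> x}"
      then show "y \<le> ys ! i"
        using min[of y] le by (auto simp: v skew_dist_def split: if_splits)
    qed (use i le in auto)
    moreover have "\<exists>y\<in>set ys. y \<le> x"
      using le nth_mem[OF i] by blast
    ultimately show ?thesis
      using True eq by (simp add: predecessor_def)
  next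
    case False
    have "\<not> y \<le> x" if "y \<in> set ys" for y
      using min[OF that] False skew_dist_le_iff[OF \<open>x < B\<close>, of y] by linarith
    then show ?thesis
      using False by (auto simp: predecessor_def)
  qed
qed

section \<open>Memory layout and word RAM programs\<close>

definition layout :: "nat \<Rightarrow> nat list \<Rightarrow> nat list" where
  "layout B ys = (length ys - 1) # B # ys"

text \<open>Entries are recomputed from the key in cell \<open>i + 2\<close> and the factor in cell
  1. The jump target 10 is the program length: for a key at most the column index the machine halts
  with the plain difference; otherwise that difference has wrapped around and is
  overwritten.\<close>

definition entry_program :: "instr list" where
  "entry_program =
    [Const 2 2,
     Binop OpAdd 2 0 2,
     Load 2 2,
     Binop OpLess 3 1 2,
     Binop OpSub 0 1 2,
     JumpZero 3 10,
     Const 4 1,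
     Load 4 4,
     Binop OpSub 0 2 1,
     Binop OpMul 0 4 0]"

text \<open>Register 9 is never written and supplies the constant 0.\<close>

definition predecessor_program :: "instr list" where
  "predecessor_program =
    [Load 1 9,
     Query 9 1 0 0 2 3 4,
     Binop OpLess 3 0 2,
     Binop OpSub 1 0 2,
     Binop OpEq 0 3 9]"

lemma nat_diff_mod:
  assumes "b \<le> a" and "a < 2 ^ w"
  shows "nat ((int a - int b) mod 2 ^ w) = a - b"
proof -
  have "int (a - b) < 2 ^ w"
    using assms by (metis less_imp_diff_less of_nat_less_iff of_nat_numeral of_nat_power)
  then show ?thesis
    using assms by (simp add: of_nat_diff)
qed

text \<open>Rules for symbolic execution: \<open>numeral_eq_Suc\<close> unrolls the iteration, and
  the program counter decides which rule applies.\<close>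

lemma run_simps:
  "halted p s \<Longrightarrow> step w Q p s = s"
  "\<not> halted p s \<Longrightarrow> step w Q p s = exec_instr w Q (p ! pc s) s"
  by (simp_all add: step_def)

lemma returns_entry_skew_dist_mat:
  assumes "1 < w" and "i < length ys" and "x < m" and "m \<le> 2 ^ w" and "length ys + 2 \<le> 2 ^ w"
    and "\<forall>y\<in>set ys. y < 2 ^ w" and "\<forall>y\<in>set ys. skew_dist B y x < 2 ^ w"
  shows "returns_entry w 10 entry_program (layout B ys) (skew_dist_mat B ys m) i x"
proof -
  have w: "(2::nat) < 2 ^ w"
    using power_strict_increasing[OF assms(1), of "2::nat"] by simp
  have y: "ys ! i < 2 ^ w" "skew_dist B (ys ! i) x < 2 ^ w"
    using assms by auto
  \<comment> \<open>Neither the literals nor the address wrap around; the address also appears as an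
    iterated successor, the shape produced by \<open>numeral_eq_Suc\<close>.\<close>
  have mod: "2 mod 2 ^ w = (2::nat)" "Suc 0 mod 2 ^ w = Suc 0" "(i + 2) mod 2 ^ w = i + 2"
    "Suc (Suc i) mod 2 ^ w = Suc (Suc i)"
    using w assms by auto
  show ?thesis
  \<comment> \<open>The split decides the conditional jump. An early halt is harmless, since halted
    states are fixed points.\<close>
  proof (cases "ys ! i \<le> x")
    case True
    then show ?thesis
      using assms y nat_diff_mod[of "ys ! i" x w]
      by (simp add: returns_entry_def Let_def run_def numeral_eq_Suc run_simps halted_def
          entry_program_def layout_def zero_padded_def skew_dist_def mod[unfolded numeral_eq_Suc])
  next
    case False
    then show ?thesis
      using assms y nat_diff_mod[of x "ys ! i" w]
      by (simp add: returns_entry_def Let_def run_def numeral_eq_Suc run_simps halted_def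
          entry_program_def layout_def zero_padded_def skew_dist_def mod[unfolded numeral_eq_Suc])
  qed
qed

text \<open>Cell 0 supplies the last row index, so one query covers all of column \<open>x\<close>.
  Register 3 then receives the test \<open>x < v\<close>, overwriting the reported row, and register
  0 its negation. If \<open>v > x\<close>, the difference in register 1 wraps around, but register 0
  is 0.\<close>

lemma finds_predecessor_skew_dist_mat:
  assumes "0 < w" and "ys \<noteq> []" and "x < m" and "x < B" and "m \<le> 2 ^ w"
    and "\<forall>y\<in>set ys. skew_dist B y x < 2 ^ w"
  shows "finds_predecessor w 10 predecessor_program (layout B ys) (skew_dist_mat B ys m) (set ys) x"
proof -
  have w: "Suc 0 mod 2 ^ w = Suc 0"
    using assms(1) by (simp add: mod_less)
  show ?thesis
    unfolding finds_predecessor_def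
  proof (intro allI impI)
    fix Q assume Q: "answers_submatrix_min (skew_dist_mat B ys m) Q"
    obtain v i j where q: "Q 0 (length ys - 1) x x = (v, i, j)"
      by (metis prod_cases3)
    note col = predecessor_column_min[OF Q assms(2-4) q]
    have v: "v < 2 ^ w"
      using col(2) assms(6) by auto
    show "let s = run w Q predecessor_program 10 (layout B ys) [x] in
        halted predecessor_program s \<and> queries s \<le> 1 \<and>
        (case predecessor (set ys) x of None \<Rightarrow> regs s 0 = 0
         | Some y \<Rightarrow> regs s 0 = 1 \<and> regs s 1 = y)"
      using assms v q nat_diff_mod[of v x w] w
      by (auto simp: Let_def run_def numeral_eq_Suc run_simps halted_def
          predecessor_program_def layout_def zero_padded_def col(1))
  qed
qed

section \<open>Word length and assembly\<close>

lemma log_word_length_power_le: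
  assumes "log_word_length (real k) b n w"
  shows "(n + 2) ^ k \<le> 2 ^ w"
proof -
  \<comment> \<open>Exponentiating the lower bound on \<open>w\<close> gives polynomial room in a
    word.\<close>
  have "real ((n + 2) ^ k) = 2 powr (log 2 (real n + 2) * real k)"
    by (simp add: powr_powr[symmetric] powr_realpow add.commute)
  also have "\<dots> \<le> 2 powr real w"
    using assms by (simp add: log_word_length_def mult.commute)
  also have "\<dots> = real (2 ^ w)"
    by (simp add: powr_realpow)
  finally show ?thesis
    by (simp only: of_nat_le_iff)
qed

theorem theorem5:
  "\<exists>a::real. a \<ge> 2 \<and> (\<forall>b::real. b \<ge> a \<longrightarrow>
     (\<exists>(c::nat) (entry_prog :: instr list) (pred_prog :: instr list).
        \<forall>(n::nat) (w::nat) (S :: nat set).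
          card S = n \<and> S \<subseteq> {0..<n\<^sup>2} \<and> log_word_length a b n w \<longrightarrow>
          (\<exists>(M :: nat mat) (D :: nat list).
             monge M \<and> dim_row M \<le> 2 ^ w \<and> dim_col M \<le> 2 ^ w \<and>
             length D \<le> c * n \<and> (\<forall>d \<in> set D. d < 2 ^ w) \<and>
             (\<forall>i < dim_row M. \<forall>j < dim_col M. returns_entry w c entry_prog D M i j) \<and>
             (\<forall>x < n\<^sup>2. finds_predecessor w c pred_prog D M S x))))"
\<comment> \<open>The constant 4 is there because entries are bounded by \<open>n^4\<close>; 10
  bounds the running time of both programs and, for positive \<open>n\<close>, gives
  \<open>n + 2 \<le> 10 * n\<close>.\<close>
proof (rule exI[of _ 4], rule conjI, simp, intro allI impI, rule exI[of _ 10],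
    rule exI[of _ entry_program], rule exI[of _ predecessor_program], intro allI impI)
  fix b :: real and n w :: nat and S :: "nat set"
  assume asm: "card S = n \<and> S \<subseteq> {0..<n\<^sup>2} \<and> log_word_length 4 b n w"
  define ys where "ys = sorted_list_of_set S"
  let ?M = "skew_dist_mat (n\<^sup>2) ys (n\<^sup>2)"
  \<comment> \<open>\<open>layout\<close> takes \<open>n + 2\<close> cells, too many for the bound
    \<open>10 * n\<close> when \<open>n = 0\<close>; then there are no rows and no \<open>x\<close>,
    so the empty list does.\<close>
  let ?D = "if n = 0 then [] else layout (n\<^sup>2) ys"
  have fin: "finite S"
    using asm finite_subset by blast
  then have set_ys: "set ys = S" and len: "length ys = n" and sorted: "sorted ys"
    using asm by (auto simp: ys_def)
  have S: "y < n\<^sup>2" if "y \<in> S" for y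
    using that asm by auto
  have pow: "(n + 2) ^ 4 \<le> 2 ^ w"
    using asm log_word_length_power_le[of 4 b n w] unfolding of_nat_numeral by blast
  \<comment> \<open>The summand 3 lets one inequality yield all bounds: room for entries, for
    \<open>n\<^sup>2\<close> and for addresses up to \<open>n + 1\<close>, and
    \<open>2 ^ w \<ge> 3\<close>, which forces \<open>1 < w\<close>.\<close>
  have "(n\<^sup>2 + 3) * (n\<^sup>2 + 3) \<le> (n + 2)\<^sup>2 * (n + 2)\<^sup>2"
    by (intro mult_le_mono) (simp_all add: power2_eq_square)
  then have sq: "(n\<^sup>2 + 3) * (n\<^sup>2 + 3) \<le> 2 ^ w"
    using pow by (simp flip: power_add)
  then have n4: "n\<^sup>2 * n\<^sup>2 \<le> 2 ^ w" and n2: "n\<^sup>2 + 3 \<le> 2 ^ w"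
    by (auto simp: algebra_simps)
  have n1: "n + 2 \<le> 2 ^ w"
    using n2 le_square[of n] unfolding power2_eq_square by linarith
  have S_word: "y < 2 ^ w" if "y \<in> S" for y
    using S[OF that] n2 by linarith
  have w: "1 < w"
  proof (rule ccontr)
    assume "\<not> 1 < w"
    then have "w = 0 \<or> w = 1" by auto
    then show False using n2 by auto
  qed
  have bound: "skew_dist (n\<^sup>2) y x < 2 ^ w" if "y \<in> S" "x < n\<^sup>2" for x y
    using skew_dist_less[of y "n\<^sup>2" x] S that n4 by simp
  show "\<exists>(M :: nat mat) (D :: nat list).
             monge M \<and> dim_row M \<le> 2 ^ w \<and> dim_col M \<le> 2 ^ w \<and>
             length D \<le> 10 * n \<and> (\<forall>d \<in> set D. d < 2 ^ w) \<and>
             (\<forall>i < dim_row M. \<forall>j < dim_col M. returns_entry w 10 entry_program D M i j) \<and>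
             (\<forall>x < n\<^sup>2. finds_predecessor w 10 predecessor_program D M S x)"
  proof (rule exI[of _ ?M], rule exI[of _ ?D], intro conjI)
    show "monge ?M"
      using sorted by (rule monge_skew_dist_mat)
    show "dim_row ?M \<le> 2 ^ w" "dim_col ?M \<le> 2 ^ w"
      using len n1 n2 by simp_all
    show "length ?D \<le> 10 * n"
      using len by (simp add: layout_def)
    show "\<forall>d\<in>set ?D. d < 2 ^ w"
      using len n1 n2 S_word set_ys by (auto simp: layout_def)
    show "\<forall>i<dim_row ?M. \<forall>j<dim_col ?M. returns_entry w 10 entry_program ?D ?M i j"
    proof (intro allI impI)
      fix i j assume ij: "i < dim_row ?M" "j < dim_col ?M"
      then have "returns_entry w 10 entry_program (layout (n\<^sup>2) ys) ?M i j"
        using w len n1 n2 bound set_ys S_word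
        by (intro returns_entry_skew_dist_mat) auto
      then show "returns_entry w 10 entry_program ?D ?M i j"
        using ij len by simp
    qed
    show "\<forall>x<n\<^sup>2. finds_predecessor w 10 predecessor_program ?D ?M S x"
    proof (intro allI impI)
      fix x assume x: "x < n\<^sup>2"
      then have "n \<noteq> 0" by (cases n) simp_all
      then have "ys \<noteq> []" using len by auto
      then have "finds_predecessor w 10 predecessor_program (layout (n\<^sup>2) ys) ?M (set ys) x"
        using w x n2 bound set_ys by (intro finds_predecessor_skew_dist_mat) auto
      then show "finds_predecessor w 10 predecessor_program ?D ?M S x"
        using \<open>n \<noteq> 0\<close> set_ys by simp
    qed
  qed
qed

end
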